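(* Let $m,n$ be positive integers, let $f$ be a continuous complex-valued function on the closed unit disk, written in polar coordinates as $f(\phi,\rho)=f(\rho\cos\phi,\rho\sin\phi)$, and let $f_{j,k}=f(\phi_k,\rho_j)$, $j=0,\dots,n$, $k=0,\dots,2m-1$, be its samples on the CH1, CH2, or GL grid (with the origin either included or not included). Let $s:[0,2\pi]\times[0,1]\to\mathbb{C}$ be the disk barycentric interpolant of these data for that grid (all defined in the context). Then $s$ is a BMC function, i.e. its DFS extension $\tilde s:[0,2\pi]\times[-1,1]\to\mathbb{C}$ is a BMC function with $a=\pi$, $b=1$. Furthermore, in the case where the grid contains $\rho=0$, $s$ is a BMC-II function, i.e. $\tilde s$ is a BMC-II function.
   Context: Grids. Let $\ell=2n$ if the origin is included in the grid (then $\rho_n=0$) and $\ell=2n+1$ if it is not. For $k=0,\dots,2m-1$ and $j=0,\dots,n$, $\phi_k=\frac{\pi}{m}k$ and CH1: $\rho_j=\cos\left(\frac{j+\frac12}{\ell+1}\pi\right)$; CH2: $\rho_j=\cos\left(\frac{j}{\ell}\pi\right)$; GL: $\rho_j=z_j$, where $z_0>z_1>\dots>z_n$ are the $n+1$ roots in $[0,1]$ of the degree $\ell+1$ Legendre polynomial on $[-1,1]$. Split data. For $j=0,\dots,n$, $k=0,\dots,m-1$: $f^-_{j,k}=\frac12(f_{j,k}-f_{j,k+m})$ and $f^+_{j,k}=\frac12(f_{j,k}+f_{j,k+m})$. Radial interpolants $v^{\rm e}_k(\rho)$, $v^{\rm o}_k(\rho)$, $k=0,\dots,m-1$. Here (and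 for $s$ below) the value of any barycentric formula at a point where terms are singular is understood as the limiting value (removable singularity). For suitable coefficients $c_j$ (specified below): Origin included: $$v^{\rm e}_k(\rho)=\frac{\sum_{j=0}^n\frac{c_j}{\rho^2-\rho_j^2}f^+_{j,k}}{\sum_{j=0}^n\frac{c_j}{\rho^2-\rho_j^2}},\qquad v^{\rm o}_k(\rho)=\rho\,\frac{\sum_{j=0}^n\frac{c_j\rho_j}{\rho^2-\rho_j^2}f^-_{j,k}}{\sum_{j=0}^n\frac{c_j\rho_j^2}{\rho^2-\rho_j^2}},$$ with CH1: $c_j=(-1)^j\sin\left(\frac{2j+1}{4n+2}\pi\right)$ for $j<n$, and $c_n$ equal to one half of this expression at $j=n$; CH2: $c_j=(-1)^j$ for $0<j<n$, $c_0=\frac12$, $c_n=\frac12(-1)^n$; GL: $c_j=w_j:=\left(\prod_{i=0,\,i\ne j}^{n}(\rho_j^2-\rho_i^2)\right)^{-1}$. Origin not included: $$v^{\rm e}_k(\rho)=\frac{\sum_{j=0}^n\frac{c_j\rho_j}{\rho^2-\rho_j^2}f^+_{j,k}}{\sum_{j=0}^n\frac{c_j\rho_j}{\rho^2-\rho_j^2}},\qquad v^{\rm o}_k(\rho)=\rho\,\frac{\sum_{j=0}^n\frac{c_j}{\rho^2-\rho_j^2}f^-_{j,k}}{\sum_{j=0}^n\frac{c_j\rho_j}{\rho^2-\rho_j^2}},$$ with CH1: $c_j=(-1)^j\sin\left(\frac{2j+1}{4n+4}\pi\right)$; CH2: $c_0=\frac12$ and $c_j=(-1)^j$ for $1\le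 j\le n$; GL: $c_j=w_j/\rho_j$ with $w_j=\left(\prod_{i=0,\,i\ne j}^{n}(\rho_j^2-\rho_i^2)\right)^{-1}$. Disk barycentric interpolant: $$s(\phi,\rho)=\begin{cases}\dfrac{\sum_{k=0}^{m-1}(-1)^k\left[\cot(\phi-\phi_k)\,v^{\rm e}_k(\rho)+\csc(\phi-\phi_k)\,v^{\rm o}_k(\rho)\right]}{\sum_{k=0}^{m-1}(-1)^k\cot(\phi-\phi_k)}, & m\text{ even},\\[3ex] \dfrac{\sum_{k=0}^{m-1}(-1)^k\left[\csc(\phi-\phi_k)\,v^{\rm e}_k(\rho)+\cot(\phi-\phi_k)\,v^{\rm o}_k(\rho)\right]}{\sum_{k=0}^{m-1}(-1)^k\csc(\phi-\phi_k)}, & m\text{ odd}.\end{cases}$$ DFS extension for the disk. For $s:[0,2\pi]\times[0,1]\to\mathbb{C}$, put $g(\phi,\rho)=s(\phi,\rho)$ and $h(\phi,\rho)=s(\phi+\pi,\rho)$ on $[0,\pi]\times[0,1]$; then $\tilde s$ on $[0,2\pi]\times[-1,1]$ equals $g(\phi,\rho)$ on $[0,\pi]\times[0,1]$, $h(\phi-\pi,\rho)$ on $[\pi,2\pi]\times[0,1]$, $g(\phi-\pi,-\rho)$ on $[\pi,2\pi]\times[-1,0]$, and $h(\phi,-\rho)$ on $[0,\pi]\times[-1,0]$ (that these agree on overlaps is part of the assertion). BMC functions. Let $a,b>0$. A function $F:[0,2a]\times[-b,b]\to\mathbb{C}$ is a block-mirror-centrosymmetric (BMC) function if it is $2a$-periodic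 in its first variable (i.e. $F(0,y)=F(2a,y)$ for all $y$) and there are functions $g,h:[0,a]\times[0,b]\to\mathbb{C}$ such that $F(x,y)=g(x,y)$ on $[0,a]\times[0,b]$, $F(x,y)=h(x-a,y)$ on $[a,2a]\times[0,b]$, $F(x,y)=h(x,-y)$ on $[0,a]\times[-b,0]$, and $F(x,y)=g(x-a,-y)$ on $[a,2a]\times[-b,0]$. A BMC function $F$ is a BMC-II function if in addition $F(\cdot,0)$ is constant. *)

theory Defs
  imports "HOL-Analysis.Analysis" "HOL-Computational_Algebra.Polynomial"
begin

datatype grid_kind = CH1 | CH2 | GL

text \<open>Rodrigues' formula.\<close>

definition legendre_poly :: "nat \<Rightarrow> real poly" where
  "legendre_poly N = smult (1 / (2 ^ N * fact N)) ((pderiv ^^ N) ([:-1, 0, 1:] ^ N))"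

text \<open>The roots in \<open>[0,1]\<close> are listed in decreasing order.\<close>

definition legendre_node :: "nat \<Rightarrow> nat \<Rightarrow> real" where
  "legendre_node N j =
     rev (sorted_list_of_set {x. 0 \<le> x \<and> x \<le> 1 \<and> poly (legendre_poly N) x = 0}) ! j"

text \<open>Throughout, the flag \<open>orig\<close> says whether the origin is included in the grid.\<close>

definition grid_ell :: "bool \<Rightarrow> nat \<Rightarrow> nat" where
  "grid_ell orig n = (if orig then 2 * n else 2 * n + 1)"

fun grid_rho :: "grid_kind \<Rightarrow> bool \<Rightarrow> nat \<Rightarrow> nat \<Rightarrow> real" where
  "grid_rho CH1 orig n j = cos ((real j + 1 / 2) / (real (grid_ell orig n) + 1) * pi)"
| "grid_rho CH2 orig n j = cos (real j / real (grid_ell orig n) * pi)"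
| "grid_rho GL orig n j = legendre_node (grid_ell orig n + 1) j"

definition grid_phi :: "nat \<Rightarrow> nat \<Rightarrow> real" where
  "grid_phi m k = pi / real m * real k"

definition gl_weight :: "bool \<Rightarrow> nat \<Rightarrow> nat \<Rightarrow> real" where
  "gl_weight orig n j =
     inverse (\<Prod>i\<in>{0..n} - {j}. (grid_rho GL orig n j)\<^sup>2 - (grid_rho GL orig n i)\<^sup>2)"

fun bary_coeff :: "grid_kind \<Rightarrow> bool \<Rightarrow> nat \<Rightarrow> nat \<Rightarrow> real" where
  "bary_coeff CH1 True n j =
     (if j < n then 1 else 1 / 2) * ((-1) ^ j * sin ((2 * real j + 1) / (4 * real n + 2) * pi))"
| "bary_coeff CH2 True n j = (if 0 < j \<and> j < n then 1 else 1 / 2) * (-1) ^ j"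
| "bary_coeff GL True n j = gl_weight True n j"
| "bary_coeff CH1 False n j = (-1) ^ j * sin ((2 * real j + 1) / (4 * real n + 4) * pi)"
| "bary_coeff CH2 False n j = (if j = 0 then 1 / 2 else (-1) ^ j)"
| "bary_coeff GL False n j = gl_weight False n j / grid_rho GL False n j"

definition grid_samples ::
  "grid_kind \<Rightarrow> bool \<Rightarrow> nat \<Rightarrow> nat \<Rightarrow> (real \<times> real \<Rightarrow> complex) \<Rightarrow> nat \<Rightarrow> nat \<Rightarrow> complex" where
  "grid_samples G orig m n f j k =
     f (grid_rho G orig n j * cos (grid_phi m k), grid_rho G orig n j * sin (grid_phi m k))"

definition data_minus :: "nat \<Rightarrow> (nat \<Rightarrow> nat \<Rightarrow> complex) \<Rightarrow> nat \<Rightarrow> nat \<Rightarrow> complex" where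
  "data_minus m d j k = (d j k - d j (k + m)) / 2"

definition data_plus :: "nat \<Rightarrow> (nat \<Rightarrow> nat \<Rightarrow> complex) \<Rightarrow> nat \<Rightarrow> nat \<Rightarrow> complex" where
  "data_plus m d j k = (d j k + d j (k + m)) / 2"

text \<open>
  On the set \<open>S\<close> of points where a formula \<open>F\<close> has singular terms, its value is the limiting value
  (division by zero would give an unintended value there).
\<close>

definition limiting_value :: "real set \<Rightarrow> (real \<Rightarrow> complex) \<Rightarrow> real \<Rightarrow> complex" where
  "limiting_value S F x = (if x \<in> S then Lim (at x) F else F x)"

definition radial_sing :: "grid_kind \<Rightarrow> bool \<Rightarrow> nat \<Rightarrow> real set" where
  "radial_sing G orig n = {r. \<exists>j\<le>n. r\<^sup>2 - (grid_rho G orig n j)\<^sup>2 = 0}"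

definition radial_even ::
  "grid_kind \<Rightarrow> bool \<Rightarrow> nat \<Rightarrow> nat \<Rightarrow> (nat \<Rightarrow> nat \<Rightarrow> complex) \<Rightarrow> nat \<Rightarrow> real \<Rightarrow> complex" where
  "radial_even G orig m n d k =
     (let \<rho> = grid_rho G orig n; c = bary_coeff G orig n in
      limiting_value (radial_sing G orig n)
        (if orig then
           (\<lambda>r. (\<Sum>j=0..n. of_real (c j / (r\<^sup>2 - (\<rho> j)\<^sup>2)) * data_plus m d j k)
                / of_real (\<Sum>j=0..n. c j / (r\<^sup>2 - (\<rho> j)\<^sup>2)))
         else
           (\<lambda>r. (\<Sum>j=0..n. of_real (c j * \<rho> j / (r\<^sup>2 - (\<rho> j)\<^sup>2)) * data_plus m d j k)
                / of_real (\<Sum>j=0..n. c j * \<rho> j / (r\<^sup>2 - (\<rho> j)\<^sup>2)))))"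

definition radial_odd ::
  "grid_kind \<Rightarrow> bool \<Rightarrow> nat \<Rightarrow> nat \<Rightarrow> (nat \<Rightarrow> nat \<Rightarrow> complex) \<Rightarrow> nat \<Rightarrow> real \<Rightarrow> complex" where
  "radial_odd G orig m n d k =
     (let \<rho> = grid_rho G orig n; c = bary_coeff G orig n in
      limiting_value (radial_sing G orig n)
        (if orig then
           (\<lambda>r. of_real r *
                ((\<Sum>j=0..n. of_real (c j * \<rho> j / (r\<^sup>2 - (\<rho> j)\<^sup>2)) * data_minus m d j k)
                 / of_real (\<Sum>j=0..n. c j * (\<rho> j)\<^sup>2 / (r\<^sup>2 - (\<rho> j)\<^sup>2))))
         else
           (\<lambda>r. of_real r *
                ((\<Sum>j=0..n. of_real (c j / (r\<^sup>2 - (\<rho> j)\<^sup>2)) * data_minus m d j k)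
                 / of_real (\<Sum>j=0..n. c j * \<rho> j / (r\<^sup>2 - (\<rho> j)\<^sup>2))))))"

definition csc :: "real \<Rightarrow> real" where
  "csc x = 1 / sin x"

definition angular_sing :: "nat \<Rightarrow> real set" where
  "angular_sing m = {t. \<exists>k<m. sin (t - grid_phi m k) = 0}"

definition disk_interpolant ::
  "grid_kind \<Rightarrow> bool \<Rightarrow> nat \<Rightarrow> nat \<Rightarrow> (nat \<Rightarrow> nat \<Rightarrow> complex) \<Rightarrow> real \<Rightarrow> real \<Rightarrow> complex" where
  "disk_interpolant G orig m n d t r =
     (let ve = radial_even G orig m n d; vo = radial_odd G orig m n d; \<phi> = grid_phi m in
      limiting_value (angular_sing m)
        (if even m then
           (\<lambda>t. (\<Sum>k<m. (-1) ^ k * (of_real (cot (t - \<phi> k)) * ve k r + of_real (csc (t - \<phi> k)) * vo k r))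
                / of_real (\<Sum>k<m. (-1) ^ k * cot (t - \<phi> k)))
         else
           (\<lambda>t. (\<Sum>k<m. (-1) ^ k * (of_real (csc (t - \<phi> k)) * ve k r + of_real (cot (t - \<phi> k)) * vo k r))
                / of_real (\<Sum>k<m. (-1) ^ k * csc (t - \<phi> k)))) t)"

definition glued_blocks ::
  "real \<Rightarrow> real \<Rightarrow> (real \<Rightarrow> real \<Rightarrow> complex) \<Rightarrow> (real \<Rightarrow> real \<Rightarrow> complex) \<Rightarrow> (real \<Rightarrow> real \<Rightarrow> complex) \<Rightarrow> bool" where
  "glued_blocks a b g h F \<longleftrightarrow>
     (\<forall>x\<in>{0..a}. \<forall>y\<in>{0..b}. F x y = g x y) \<and>
     (\<forall>x\<in>{a..2 * a}. \<forall>y\<in>{0..b}. F x y = h (x - a) y) \<and>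
     (\<forall>x\<in>{0..a}. \<forall>y\<in>{-b..0}. F x y = h x (- y)) \<and>
     (\<forall>x\<in>{a..2 * a}. \<forall>y\<in>{-b..0}. F x y = g (x - a) (- y))"

text \<open>
  The extension is a relation, since the four defining clauses overlap on the block boundaries:
  existence of \<open>F\<close> says that they are consistent, and \<open>F\<close> is then unique on
  \<open>[0,2\<pi>] \<times> [-1,1]\<close>.
\<close>

definition dfs_extension :: "(real \<Rightarrow> real \<Rightarrow> complex) \<Rightarrow> (real \<Rightarrow> real \<Rightarrow> complex) \<Rightarrow> bool" where
  "dfs_extension s F \<longleftrightarrow> glued_blocks pi 1 s (\<lambda>t r. s (t + pi) r) F"

definition bmc :: "real \<Rightarrow> real \<Rightarrow> (real \<Rightarrow> real \<Rightarrow> complex) \<Rightarrow> bool" where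
  "bmc a b F \<longleftrightarrow> (\<forall>y\<in>{-b..b}. F 0 y = F (2 * a) y) \<and> (\<exists>g h. glued_blocks a b g h F)"

definition bmc_II :: "real \<Rightarrow> real \<Rightarrow> (real \<Rightarrow> real \<Rightarrow> complex) \<Rightarrow> bool" where
  "bmc_II a b F \<longleftrightarrow> bmc a b F \<and> (\<exists>c. \<forall>x\<in>{0..2 * a}. F x 0 = c)"

end

theory Submission
  imports Defs
begin

text \<open>
  The blocks of the extension fit together as soon as \<open>s\<close> is \<open>2\<pi>\<close>-periodic in the angle and
  \<open>s(\<cdot>,0)\<close> is \<open>\<pi>\<close>-periodic. The former is inherited from cotangent and cosecant. The latter holds
  because the odd radial interpolants vanish at the origin and the remaining angular formula has
  numerator and denominator of the same parity under \<open>\<phi> \<mapsto> \<phi> + \<pi>\<close>.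

  If the origin is a node, the even radial interpolants all take the value \<open>f(0,0)\<close> there, so that
  \<open>s(\<cdot>,0)\<close> is the constant \<open>f(0,0)\<close>, provided that the angular denominators do not vanish away
  from their poles; in terms of roots of unity they are, up to a nonzero factor, \<open>1/sin(m\<phi>)\<close>.
  At the origin one also needs that the coefficients \<open>c\<^sub>j\<close>, \<open>j < n\<close>, have a nonzero sum. For GL this,
  and the location of the nodes, rests on the Legendre polynomial of degree \<open>N\<close> having \<open>N\<close> distinct
  roots in \<open>(-1,1)\<close>, lying symmetrically about \<open>0\<close>.
\<close>

subsection \<open>The angular denominators\<close>

lemma sum_powers_root_of_unity:
  fixes w :: complex
  assumes "w ^ m = 1" "w \<noteq> 1"
  shows "(\<Sum>k<m. w ^ k) = 0"
  using assms by (simp add: geometric_sum)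

text \<open>Partial fraction expansion of \<open>m * z ^ (p - 1) / (z ^ m - 1)\<close> over the
  \<open>m\<close>-th roots of unity, the powers of the primitive root \<open>w\<close>. Since
  \<open>z ^ m - 1\<close> is a difference of \<open>m\<close>-th powers of \<open>z\<close> and
  \<open>w ^ k\<close>, each quotient by \<open>z - w ^ k\<close> is a geometric sum; after
  exchanging the sums, orthogonality leaves one power of \<open>z\<close>.\<close>

lemma partial_fractions_roots_of_unity:
  fixes z w :: complex
  assumes primitive: "\<And>q. w ^ q = 1 \<longleftrightarrow> m dvd q" and "1 \<le> p" "p \<le> m" and z: "z ^ m \<noteq> 1"
  shows "(\<Sum>k<m. w ^ (k * p) / (z - w ^ k)) = of_nat m * z ^ (p - 1) / (z ^ m - 1)"
proof -
  have wkm: "(w ^ k) ^ m = 1" for k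
    using primitive[of "k * m"] by (simp add: power_mult)
  \<comment> \<open>The exponent \<open>p + (m - Suc j)\<close> lies between \<open>1\<close> and
    \<open>2 * m - 1\<close>, so \<open>m\<close> divides it only if it equals \<open>m\<close>,
    that is, for \<open>j = p - 1\<close>.\<close>
  have inner: "(\<Sum>k<m. (w ^ (p + (m - Suc j))) ^ k) = (if j = p - 1 then of_nat m else 0)"
    if "j < m" for j
  proof (cases "j = p - 1")
    case True
    then have "p + (m - Suc j) = m" using assms that by simp
    then have "w ^ (p + (m - Suc j)) = 1" using primitive by simp
    then show ?thesis using True by simp
  next
    case False
    have "\<not> m dvd p + (m - Suc j)"
    proof
      assume "m dvd p + (m - Suc j)"
      then obtain q where q: "p + (m - Suc j) = m * q" by blast
      have "m * q < m * 2" "0 < m * q" unfolding q[symmetric] using assms that by auto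
      then have "q = 1" by simp
      with q False that assms show False by auto
    qed
    then show ?thesis
      using False primitive by (simp add: sum_powers_root_of_unity[OF wkm])
  qed
  have expand: "(w ^ (p + q)) ^ k = w ^ (k * p) * (w ^ k) ^ q" for q k
    by (simp add: power_mult[symmetric] power_add[symmetric] algebra_simps)
  have summand: "w ^ (k * p) / (z - w ^ k)
      = (\<Sum>j<m. z ^ j * (w ^ (p + (m - Suc j))) ^ k) / (z ^ m - 1)" for k
  proof -
    have "z \<noteq> w ^ k" using z wkm by auto
    have geo: "z ^ m - 1 = (z - w ^ k) * (\<Sum>j<m. (w ^ k) ^ (m - Suc j) * z ^ j)"
      using power_diff_sumr2[of z m "w ^ k"] wkm by simp
    have "w ^ (k * p) / (z - w ^ k) = w ^ (k * p) * ((z ^ m - 1) / (z - w ^ k)) / (z ^ m - 1)"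
      using z by simp
    also have "(z ^ m - 1) / (z - w ^ k) = (\<Sum>j<m. (w ^ k) ^ (m - Suc j) * z ^ j)"
      using \<open>z \<noteq> w ^ k\<close> by (simp add: geo)
    also have "w ^ (k * p) * \<dots> = (\<Sum>j<m. z ^ j * (w ^ (p + (m - Suc j))) ^ k)"
      unfolding sum_distrib_left expand by (intro sum.cong refl) (simp only: mult_ac)
    finally show ?thesis .
  qed
  have "(\<Sum>k<m. w ^ (k * p) / (z - w ^ k))
      = (\<Sum>j<m. z ^ j * (\<Sum>k<m. (w ^ (p + (m - Suc j))) ^ k)) / (z ^ m - 1)"
    unfolding summand sum_divide_distrib[symmetric] sum_distrib_left by (subst sum.swap) simp
  also have "(\<Sum>j<m. z ^ j * (\<Sum>k<m. (w ^ (p + (m - Suc j))) ^ k))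
      = (\<Sum>j<m. if j = p - 1 then of_nat m * z ^ (p - 1) else 0)"
    by (intro sum.cong refl) (subst inner; simp)
  also have "\<dots> = of_nat m * z ^ (p - 1)"
    using assms by simp
  finally show ?thesis .
qed

lemma cis_grid_phi: "cis (grid_phi m k) = cis (pi / real m) ^ k"
  by (simp add: grid_phi_def Complex.DeMoivre mult.commute)

text \<open>With \<open>z = (cis t)\<^sup>2\<close> and
  \<open>w = (cis (pi / real m))\<^sup>2\<close>, the sine is \<open>z - w ^ k\<close> up to a
  nonzero factor; this turns the trigonometric sums into rational functions of \<open>z\<close>.
  Being free of division, the identity also holds at the singular angles.\<close>

lemma sin_diff_grid_phi:
  "2 * \<i> * cis t * cis (pi / real m) ^ k * complex_of_real (sin (t - grid_phi m k))
     = (cis t)\<^sup>2 - ((cis (pi / real m))\<^sup>2) ^ k"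
proof -
  have "2 * \<i> * cis a * cis b * complex_of_real (sin (a - b)) = (cis a)\<^sup>2 - (cis b)\<^sup>2" for a b
  proof -
    have *: "2 * \<i> * complex_of_real (sin (a - b)) = cis (a - b) - cis (- (a - b))"
      by (simp add: complex_eq_iff del: minus_diff_eq)
    have "2 * \<i> * cis a * cis b * complex_of_real (sin (a - b))
        = cis a * cis b * (2 * \<i> * complex_of_real (sin (a - b)))"
      by (simp only: mult_ac)
    also have "\<dots> = cis (a + b) * (cis (a - b) - cis (- (a - b)))"
      by (simp only: * cis_mult)
    also have "\<dots> = (cis a)\<^sup>2 - (cis b)\<^sup>2"
      by (simp add: right_diff_distrib cis_mult power2_eq_square)
    finally show ?thesis .
  qed
  from this[of t "grid_phi m k"] show ?thesis
    by (simp add: cis_grid_phi power_mult[symmetric] mult.commute)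
qed

lemma cos_diff_grid_phi:
  "2 * cis t * cis (pi / real m) ^ k * complex_of_real (cos (t - grid_phi m k))
     = (cis t)\<^sup>2 + ((cis (pi / real m))\<^sup>2) ^ k"
proof -
  have "2 * cis a * cis b * complex_of_real (cos (a - b)) = (cis a)\<^sup>2 + (cis b)\<^sup>2" for a b
  proof -
    have *: "2 * complex_of_real (cos (a - b)) = cis (a - b) + cis (- (a - b))"
      by (simp add: complex_eq_iff del: minus_diff_eq)
    have "2 * cis a * cis b * complex_of_real (cos (a - b))
        = cis a * cis b * (2 * complex_of_real (cos (a - b)))"
      by (simp only: mult_ac)
    also have "\<dots> = cis (a + b) * (cis (a - b) + cis (- (a - b)))"
      by (simp only: * cis_mult)
    also have "\<dots> = (cis a)\<^sup>2 + (cis b)\<^sup>2"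
      by (simp add: distrib_left cis_mult power2_eq_square)
    finally show ?thesis .
  qed
  from this[of t "grid_phi m k"] show ?thesis
    by (simp add: cis_grid_phi power_mult[symmetric] mult.commute)
qed

context
  fixes m :: nat and t :: real
  assumes m: "1 \<le> m" and regular: "t \<notin> angular_sing m"
begin

lemma root_of_unity_primitive: "(cis (pi / real m))\<^sup>2 ^ q = 1 \<longleftrightarrow> m dvd q"
proof -
  have "(cis (pi / real m))\<^sup>2 ^ q = exp (2 * of_real pi * \<i> * of_nat q / of_nat m)"
    by (simp add: cis_conv_exp exp_of_nat_mult[symmetric] algebra_simps)
  then show ?thesis using complex_root_unity_eq_1[OF m] by simp
qed

lemma regular_diff_nonzero:
  assumes "k < m"
  shows "(cis t)\<^sup>2 - ((cis (pi / real m))\<^sup>2) ^ k \<noteq> 0"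
proof -
  have "sin (t - grid_phi m k) \<noteq> 0"
    using regular assms unfolding angular_sing_def by blast
  then show ?thesis unfolding sin_diff_grid_phi[symmetric] by simp
qed

text \<open>Otherwise \<open>(cis t)\<^sup>2\<close> would be one of the \<open>m\<close>-th roots
  of unity, which are squares of the \<open>cis (grid_phi m k)\<close>, and \<open>t\<close> would
  be singular.\<close>

lemma regular_power_ne_1: "((cis t)\<^sup>2) ^ m \<noteq> 1"
proof
  assume "((cis t)\<^sup>2) ^ m = 1"
  then have "(cis t)\<^sup>2 \<in> {exp (2 * of_real pi * \<i> * of_nat j / of_nat m) | j. j < m}"
    using complex_roots_unity[OF m] by blast
  then obtain j where "j < m" "(cis t)\<^sup>2 = exp (2 * of_real pi * \<i> * of_nat j / of_nat m)"
    by blast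
  moreover have "exp (2 * of_real pi * \<i> * of_nat j / of_nat m) = (cis (pi / real m))\<^sup>2 ^ j"
    by (simp add: cis_conv_exp exp_of_nat_mult[symmetric] algebra_simps)
  ultimately show False using regular_diff_nonzero[of j] by simp
qed

lemma csc_diff_grid_phi:
  assumes "k < m"
  shows "complex_of_real (csc (t - grid_phi m k))
    = 2 * \<i> * cis t * (cis (pi / real m) ^ k / ((cis t)\<^sup>2 - ((cis (pi / real m))\<^sup>2) ^ k))"
  using regular_diff_nonzero[OF assms] unfolding sin_diff_grid_phi[symmetric]
  by (simp add: csc_def)

lemma cot_diff_grid_phi:
  assumes "k < m"
  shows "complex_of_real (cot (t - grid_phi m k))
    = \<i> * (((cis t)\<^sup>2 + ((cis (pi / real m))\<^sup>2) ^ k) / ((cis t)\<^sup>2 - ((cis (pi / real m))\<^sup>2) ^ k))"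
  using regular_diff_nonzero[OF assms]
  unfolding sin_diff_grid_phi[symmetric] cos_diff_grid_phi[symmetric]
  by (simp add: cot_def)

lemma cis_pi_div_power: "cis (pi / real m) ^ m = -1"
  using m by (simp add: Complex.DeMoivre)

text \<open>The sum equals \<open>m / sin (m * t)\<close>. For \<open>m = 2 * r + 1\<close> the sign
  and the factor \<open>cis (pi / real m) ^ k\<close> merge into \<open>w ^ (k * (r + 1))\<close>,
  because \<open>- cis (pi / real m)\<close> is the \<open>(m + 1)\<close>-th power of
  \<open>cis (pi / real m)\<close>.\<close>

lemma alternating_csc_sum_nonzero:
  assumes "odd m"
  shows "(\<Sum>k<m. (-1) ^ k * csc (t - grid_phi m k)) \<noteq> 0"
proof -
  define z where "z = (cis t)\<^sup>2"
  define w where "w = (cis (pi / real m))\<^sup>2"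
  from assms obtain r where r: "m = 2 * r + 1" by (rule oddE)
  define p where "p = r + 1"
  have pow: "(-1) ^ k * cis (pi / real m) ^ k = w ^ (k * p)" for k
  proof -
    have "- cis (pi / real m) = cis (pi / real m) ^ (m + 1)"
      by (simp add: cis_pi_div_power)
    also have "\<dots> = w ^ p"
      unfolding w_def power_mult[symmetric] by (simp add: r p_def)
    finally have "(- cis (pi / real m)) ^ k = w ^ (k * p)"
      by (simp only: power_mult[symmetric] mult.commute)
    then show ?thesis by (simp add: power_minus[of "cis (pi / real m)"])
  qed
  have "complex_of_real (\<Sum>k<m. (-1) ^ k * csc (t - grid_phi m k))
      = (\<Sum>k<m. 2 * \<i> * cis t * (w ^ (k * p) / (z - w ^ k)))"
    unfolding of_real_sum
    by (intro sum.cong refl) (simp add: csc_diff_grid_phi[folded z_def w_def] pow[symmetric])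
  also have "\<dots> = 2 * \<i> * cis t * (of_nat m * z ^ (p - 1) / (z ^ m - 1))"
    unfolding sum_distrib_left[symmetric]
    by (subst partial_fractions_roots_of_unity)
       (use root_of_unity_primitive regular_power_ne_1 r in \<open>auto simp: z_def w_def p_def\<close>)
  also have "\<dots> \<noteq> 0"
    using m regular_power_ne_1 by (auto simp: z_def)
  finally show ?thesis by (metis of_real_0)
qed

text \<open>Again the sum is \<open>m / sin (m * t)\<close>. For \<open>m = 2 * r\<close> the sign
  is itself a power, \<open>w ^ (k * r)\<close>, and the two terms of the cotangent numerator give
  partial fractions with \<open>p = r\<close> and \<open>p = r + 1\<close>.\<close>

lemma alternating_cot_sum_nonzero:
  assumes "even m"
  shows "(\<Sum>k<m. (-1) ^ k * cot (t - grid_phi m k)) \<noteq> 0"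
proof -
  define z where "z = (cis t)\<^sup>2"
  define w where "w = (cis (pi / real m))\<^sup>2"
  from assms obtain r where r: "m = 2 * r" by (rule evenE)
  have pow: "(-1) ^ k = w ^ (k * r)" for k
  proof -
    have "-1 = w ^ r"
      unfolding w_def power_mult[symmetric] using cis_pi_div_power by (simp add: r)
    then show ?thesis by (simp add: power_mult[symmetric] mult.commute)
  qed
  have "complex_of_real (\<Sum>k<m. (-1) ^ k * cot (t - grid_phi m k))
      = (\<Sum>k<m. \<i> * (z * (w ^ (k * r) / (z - w ^ k)) + w ^ (k * (r + 1)) / (z - w ^ k)))"
    unfolding of_real_sum
    by (intro sum.cong refl)
       (simp add: cot_diff_grid_phi pow z_def w_def add_divide_distrib power_add algebra_simps)
  also have "\<dots> = \<i> * (z * (\<Sum>k<m. w ^ (k * r) / (z - w ^ k)) + (\<Sum>k<m. w ^ (k * (r + 1)) / (z - w ^ k)))"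
    by (simp only: sum_distrib_left[symmetric] sum.distrib)
  also have "\<dots> = \<i> * (z * (of_nat m * z ^ (r - 1) / (z ^ m - 1)) + of_nat m * z ^ (r + 1 - 1) / (z ^ m - 1))"
    by (subst (1 2) partial_fractions_roots_of_unity)
       (use root_of_unity_primitive regular_power_ne_1 r m in \<open>auto simp: z_def w_def\<close>)
  \<comment> \<open>Here \<open>r\<close> is positive because \<open>m\<close> is, so the truncated
    subtraction \<open>r - 1\<close> is exact and both terms contribute
    \<open>z ^ r\<close>.\<close>
  also have "\<dots> = \<i> * (2 * of_nat m * z ^ r / (z ^ m - 1))"
    using r m by (cases r) (auto simp: field_simps)
  also have "\<dots> \<noteq> 0"
    using m regular_power_ne_1 by (auto simp: z_def)
  finally show ?thesis by (metis of_real_0)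
qed

end

subsection \<open>Roots of Legendre polynomials\<close>

text \<open>Rolle's theorem with counting. Confining \<open>T\<close> strictly between the extreme
  roots keeps the roots found in successive gaps distinct, and later keeps them away from the
  endpoints \<open>-1\<close> and \<open>1\<close>.\<close>

lemma card_roots_pderiv:
  fixes p :: "real poly"
  assumes "finite S" "card S = Suc c" "\<And>x. x \<in> S \<Longrightarrow> poly p x = 0"
  shows "\<exists>T. finite T \<and> card T = c \<and> T \<subseteq> {Min S<..<Max S} \<and> (\<forall>x\<in>T. poly (pderiv p) x = 0)"
  using assms
proof (induction c arbitrary: S)
  case 0
  show ?case by (rule exI[of _ "{}"]) simp
next
  case (Suc c)
  define b where "b = Max S"
  define S' where "S' = S - {b}"
  have "S \<noteq> {}" using Suc.prems by auto
  then have "b \<in> S" unfolding b_def using Suc.prems by simp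
  have S': "finite S'" "card S' = Suc c" using Suc.prems \<open>b \<in> S\<close> by (auto simp: S'_def)
  then have "S' \<noteq> {}" by auto
  obtain T where T: "finite T" "card T = c" "T \<subseteq> {Min S'<..<Max S'}" "\<forall>x\<in>T. poly (pderiv p) x = 0"
    using Suc.IH[OF S'] Suc.prems by (auto simp: S'_def)
  define a where "a = Max S'"
  have "a \<in> S'" unfolding a_def using S' \<open>S' \<noteq> {}\<close> by simp
  then have "a \<in> S" "a \<noteq> b" by (auto simp: S'_def)
  then have "a < b" using Max_ge[OF Suc.prems(1), of a] by (simp add: b_def)
  obtain x where x: "a < x" "x < b" "poly p b - poly p a = (b - a) * poly (pderiv p) x"
    using poly_MVT[OF \<open>a < b\<close>] by blast
  have "poly (pderiv p) x = 0"
    using x Suc.prems(3)[OF \<open>a \<in> S\<close>] Suc.prems(3)[OF \<open>b \<in> S\<close>] \<open>a < b\<close> by simp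
  moreover have "Min S \<le> Min S'"
    using \<open>S' \<noteq> {}\<close> Suc.prems by (intro Min_antimono) (auto simp: S'_def)
  moreover have "Min S' \<le> a" using \<open>a \<in> S'\<close> S' by simp
  \<comment> \<open>All of \<open>T\<close> lies to the left of \<open>a\<close>, whereas
    \<open>x\<close> lies to its right.\<close>
  moreover have "x \<notin> T" using T x by (auto simp: a_def)
  ultimately show ?case
    using T x \<open>a < b\<close> by (intro exI[of _ "insert x T"]) (auto simp: a_def b_def)
qed

text \<open>Differentiation lowers the multiplicity of a factor by at most one.\<close>

lemma dvd_pderiv:
  fixes a p :: "real poly"
  assumes "a ^ Suc k dvd p"
  shows "a ^ k dvd pderiv p"
proof -
  from assms obtain q where "p = a ^ Suc k * q" by blast
  then have "pderiv p = a ^ Suc k * pderiv q + q * pderiv (a ^ Suc k)"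
    by (simp only: pderiv_mult)
  moreover have "a ^ k dvd pderiv (a ^ Suc k)"
    unfolding pderiv_power_Suc by (intro dvd_mult2 dvd_smult dvd_refl)
  ultimately show ?thesis
    by (simp add: dvd_add dvd_mult2 dvd_mult)
qed

lemma dvd_higher_pderiv:
  fixes a :: "real poly"
  assumes "k \<le> N"
  shows "a ^ (N - k) dvd (pderiv ^^ k) (a ^ N)"
  using assms
proof (induction k)
  case (Suc k)
  then have "a ^ Suc (N - Suc k) dvd (pderiv ^^ k) (a ^ N)" by (simp add: Suc_diff_Suc)
  then show ?case by (simp add: dvd_pderiv)
qed simp

text \<open>As long as \<open>k < N\<close>, the \<open>k\<close>-th derivative still has the factor
  \<open>[:-1, 0, 1:]\<close>, hence vanishes at both endpoints. Its \<open>k\<close> interior roots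
  and these two yield \<open>k + 1\<close> interior roots of the next derivative.\<close>

lemma roots_higher_pderiv_Rodrigues:
  assumes "k \<le> N"
  shows "\<exists>S. finite S \<and> card S = k \<and> S \<subseteq> {-1<..<1::real} \<and>
    (\<forall>x\<in>S. poly ((pderiv ^^ k) ([:-1, 0, 1:] ^ N)) x = 0)"
  using assms
proof (induction k)
  case (Suc k)
  let ?p = "(pderiv ^^ k) ([:-1, 0, 1:] ^ N) :: real poly"
  from Suc obtain S where S: "finite S" "card S = k" "S \<subseteq> {-1<..<1}" "\<forall>x\<in>S. poly ?p x = 0"
    by auto
  have "[:-1, 0, 1::real:] dvd [:-1, 0, 1:] ^ (N - k)"
    using Suc.prems by (intro dvd_power) auto
  then have "[:-1, 0, 1::real:] dvd ?p"
    using dvd_higher_pderiv[of k N] Suc.prems by (meson Suc_leD dvd_trans)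
  then have ends: "poly ?p 1 = 0" "poly ?p (-1) = 0" by (auto elim!: dvdE)
  let ?S = "insert (-1) (insert 1 S)"
  have "card ?S = Suc (Suc k)" using S by (subst card_insert_disjoint; force)+
  then obtain T where T: "finite T" "card T = Suc k" "T \<subseteq> {Min ?S<..<Max ?S}"
      "\<forall>x\<in>T. poly (pderiv ?p) x = 0"
    using card_roots_pderiv[of ?S "Suc k" ?p] S ends by auto
  moreover have "Min ?S = -1" "Max ?S = 1"
    using S(1,3) by (intro Min_eqI Max_eqI; force)+
  ultimately show ?case by auto
qed auto

lemma degree_higher_pderiv: "degree ((pderiv ^^ k) p) = degree p - k"
  for p :: "real poly"
  by (induction k) (auto simp: degree_pderiv)

lemma degree_legendre_poly: "degree (legendre_poly N) = N"
  by (simp add: legendre_poly_def degree_higher_pderiv degree_power_eq)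

lemma legendre_poly_nonzero: "legendre_poly N \<noteq> 0"
proof (cases "N = 0")
  case True
  then show ?thesis by (simp add: legendre_poly_def)
next
  case False
  then show ?thesis using degree_legendre_poly[of N] by auto
qed

lemma poly_legendre_eq_0_iff:
  "poly (legendre_poly N) x = 0 \<longleftrightarrow> poly ((pderiv ^^ N) ([:-1, 0, 1:] ^ N)) x = 0"
  by (simp add: legendre_poly_def)

text \<open>The degree bound allows no roots beyond the \<open>N\<close> interior ones supplied by
  Rolle's theorem.\<close>

lemma legendre_roots:
  "finite {x. poly (legendre_poly N) x = 0}"
  "card {x. poly (legendre_poly N) x = 0} = N"
  "{x. poly (legendre_poly N) x = 0} \<subseteq> {-1<..<1}"
proof -
  let ?R = "{x. poly (legendre_poly N) x = 0}"
  show fin: "finite ?R" by (rule poly_roots_finite[OF legendre_poly_nonzero])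
  obtain S where S: "finite S" "card S = N" "S \<subseteq> {-1<..<1}" "S \<subseteq> ?R"
    using roots_higher_pderiv_Rodrigues[of N N] by (auto simp: poly_legendre_eq_0_iff)
  have "card ?R \<le> N"
    using card_poly_roots_bound[OF legendre_poly_nonzero] degree_legendre_poly by metis
  then have "S = ?R" using S fin by (intro card_seteq) auto
  then show "card ?R = N" "?R \<subseteq> {-1<..<1}" using S by auto
qed

lemma higher_pderiv_reflect:
  fixes p :: "real poly"
  shows "(pderiv ^^ k) (p \<circ>\<^sub>p [:0, -1:]) = smult ((-1) ^ k) ((pderiv ^^ k) p \<circ>\<^sub>p [:0, -1:])"
  by (induction k) (auto simp: pderiv_smult pderiv_pcompose pderiv_pCons)

text \<open>The power in Rodrigues' formula is an even polynomial, so its \<open>N\<close>-th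
  derivative has the parity of \<open>N\<close>.\<close>

lemma legendre_root_uminus:
  "poly (legendre_poly N) (- x) = 0 \<longleftrightarrow> poly (legendre_poly N) x = 0"
proof -
  let ?q = "[:-1, 0, 1:] ^ N :: real poly"
  have "?q \<circ>\<^sub>p [:0, -1:] = ?q"
    by (intro iffD1[OF poly_eq_poly_eq_iff] ext) (simp add: poly_pcompose)
  then have "(pderiv ^^ N) ?q = smult ((-1) ^ N) ((pderiv ^^ N) ?q \<circ>\<^sub>p [:0, -1:])"
    using higher_pderiv_reflect[of N ?q] by (simp only:)
  then have "poly ((pderiv ^^ N) ?q) x
      = poly (smult ((-1) ^ N) ((pderiv ^^ N) ?q \<circ>\<^sub>p [:0, -1:])) x"
    by (rule arg_cong)
  also have "\<dots> = (-1) ^ N * poly ((pderiv ^^ N) ?q) (- x)"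
    by (simp add: poly_pcompose)
  finally show ?thesis by (simp add: poly_legendre_eq_0_iff)
qed

text \<open>Negation matches the negative roots with the positive ones, so \<open>N\<close> is twice
  the number of positive roots plus the number of zero roots, which is \<open>0\<close> or
  \<open>1\<close> and is therefore decided by the parity of \<open>N\<close>.\<close>

lemma legendre_nonneg_roots:
  defines "R N \<equiv> {x. 0 \<le> x \<and> x \<le> 1 \<and> poly (legendre_poly N) x = 0}"
  shows "finite (R N)" "2 * card (R N) = (if even N then N else N + 1)" "0 \<in> R N \<longleftrightarrow> odd N"
proof -
  let ?A = "{x. poly (legendre_poly N) x = 0}"
  let ?P = "{x. 0 < x \<and> poly (legendre_poly N) x = 0}"
  let ?M = "{x. x < 0 \<and> poly (legendre_poly N) x = 0}"
  let ?Z = "{x. x = 0 \<and> poly (legendre_poly N) x = 0}"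
  note A = legendre_roots[of N]
  have fin: "finite ?P" "finite ?M" "finite ?Z" by (auto intro: finite_subset[OF _ A(1)])
  have R: "R N = ?P \<union> ?Z" using A(3) by (force simp: R_def)
  show "finite (R N)" using R fin by simp
  have "?M = uminus ` ?P"
  proof (intro set_eqI iffI)
    fix x assume "x \<in> ?M"
    then have "- x \<in> ?P" by (simp add: legendre_root_uminus)
    then show "x \<in> uminus ` ?P" by (intro image_eqI[of x uminus "- x"]) simp
  qed (auto simp: legendre_root_uminus)
  then have M: "card ?M = card ?P" by (simp add: card_image)
  have "N = card ?A" using A(2) by (rule sym)
  also have "\<dots> = card (?P \<union> (?M \<union> ?Z))" by (intro arg_cong[of _ _ card]) auto
  also have "\<dots> = card ?P + (card ?M + card ?Z)"
    by (use fin in \<open>simp add: card_Un_disjoint disjoint_iff\<close>)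
  finally have N: "N = 2 * card ?P + card ?Z" using M by simp
  have Z: "card ?Z = (if poly (legendre_poly N) 0 = 0 then 1 else 0)"
    by (cases "poly (legendre_poly N) 0 = 0") (auto simp: conj_commute cong: conj_cong)
  have "card (R N) = card ?P + card ?Z" unfolding R using fin by (subst card_Un_disjoint) auto
  then have RN: "2 * card (R N) = N + card ?Z" using N by linarith
  have "even N \<longleftrightarrow> even (2 * card ?P + card ?Z)" using N by (rule arg_cong)
  then have "even N \<longleftrightarrow> even (card ?Z)" by (simp only: even_add even_mult_iff even_numeral simp_thms)
  then have root: "poly (legendre_poly N) 0 = 0 \<longleftrightarrow> odd N" unfolding Z by simp
  then show "0 \<in> R N \<longleftrightarrow> odd N" by (simp add: R_def)
  show "2 * card (R N) = (if even N then N else N + 1)" unfolding RN Z using root by simp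
qed

lemma rev_sorted_list_of_set_nth:
  fixes S :: "real set"
  assumes "finite S"
  shows "i < card S \<Longrightarrow> rev (sorted_list_of_set S) ! i \<in> S"
    and "i < j \<Longrightarrow> j < card S \<Longrightarrow> rev (sorted_list_of_set S) ! j < rev (sorted_list_of_set S) ! i"
proof -
  have len: "length (sorted_list_of_set S) = card S" by simp
  show "rev (sorted_list_of_set S) ! i \<in> S" if "i < card S"
    using nth_mem[of i "rev (sorted_list_of_set S)"] that len assms by simp
  show "rev (sorted_list_of_set S) ! j < rev (sorted_list_of_set S) ! i" if "i < j" "j < card S"
    using that sorted_wrt_nth_less[OF strict_sorted_list_of_set[of S], of "card S - Suc j" "card S - Suc i"]
    by (simp add: rev_nth)
qed

lemma GL_node:
  assumes "i \<le> n"
  shows "0 \<le> grid_rho GL orig n i" "i < j \<Longrightarrow> j \<le> n \<Longrightarrow> grid_rho GL orig n j < grid_rho GL orig n i"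
    and "grid_rho GL orig n i = 0 \<longleftrightarrow> orig \<and> i = n"
proof -
  define N where "N = grid_ell orig n + 1"
  define R where "R = {x. 0 \<le> x \<and> x \<le> 1 \<and> poly (legendre_poly N) x = 0}"
  \<comment> \<open>The degree \<open>N\<close> is \<open>2 * n + 1\<close> with the origin and
    \<open>2 * n + 2\<close> without it; both give \<open>n + 1\<close> nonnegative roots.\<close>
  have R: "finite R" "0 \<in> R \<longleftrightarrow> orig" "card R = Suc n"
    using legendre_nonneg_roots[of N] unfolding R_def[symmetric]
    by (auto simp: N_def grid_ell_def split: if_splits)
  have rho: "grid_rho GL orig n = (!) (rev (sorted_list_of_set R))"
    by (rule ext) (simp add: legendre_node_def R_def N_def)
  show nonneg: "0 \<le> grid_rho GL orig n i"
    using rev_sorted_list_of_set_nth(1)[OF R(1), of i] assms R unfolding rho by (simp add: R_def)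
  show "grid_rho GL orig n j < grid_rho GL orig n i" if "i < j" "j \<le> n"
    using rev_sorted_list_of_set_nth(2)[OF R(1) that(1)] that R unfolding rho by simp
  show "grid_rho GL orig n i = 0 \<longleftrightarrow> orig \<and> i = n"
  proof
    assume 0: "grid_rho GL orig n i = 0"
    then have orig using rev_sorted_list_of_set_nth(1)[OF R(1), of i] assms R unfolding rho by simp
    moreover have "i = n"
    proof (rule ccontr)
      assume "i \<noteq> n"
      then have "grid_rho GL orig n n < 0"
        using rev_sorted_list_of_set_nth(2)[OF R(1), of i n] assms R 0 unfolding rho by simp
      moreover have "grid_rho GL orig n n \<in> R"
        using rev_sorted_list_of_set_nth(1)[OF R(1), of n] R unfolding rho by simp
      ultimately show False by (simp add: R_def)
    qed
    ultimately show "orig \<and> i = n" ..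
  next
    assume *: "orig \<and> i = n"
    then have "0 \<in> set (rev (sorted_list_of_set R))" using R by simp
    then obtain l where l: "l < Suc n" "rev (sorted_list_of_set R) ! l = 0"
      using R by (metis in_set_conv_nth length_rev length_sorted_list_of_set)
    \<comment> \<open>If the zero root stood at a position \<open>l < n\<close>, the strictly
      smaller last node would be negative.\<close>
    show "grid_rho GL orig n i = 0"
      using rev_sorted_list_of_set_nth(2)[OF R(1), of l n] l * R nonneg unfolding rho
      by (cases "l = n") auto
  qed
qed

subsection \<open>Radial interpolants at the origin\<close>

text \<open>The sum is the divided difference of the constant function \<open>1\<close>: it is the
  top coefficient of the Lagrange interpolant of that constant, and it vanishes because two or more
  nodes make the nominal degree positive.\<close>

lemma sum_inverse_prod_differences:
  fixes x :: "'i \<Rightarrow> 'a :: field"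
  assumes "finite A" "2 \<le> card A" "inj_on x A"
  shows "(\<Sum>j\<in>A. inverse (\<Prod>i\<in>A - {j}. x j - x i)) = 0"
proof -
  define w where "w j = inverse (\<Prod>i\<in>A - {j}. x j - x i)" for j
  define L where "L j = (\<Prod>i\<in>A - {j}. [:- x i, 1:])" for j
  define P where "P = (\<Sum>j\<in>A. smult (w j) (L j))"
  obtain n where n: "card A = Suc n" "1 \<le> n" using assms(2) by (cases "card A") auto
  have L: "degree (L j) = n" "coeff (L j) n = 1" if "j \<in> A" for j
  proof -
    show deg: "degree (L j) = n"
      using that n assms(1) by (simp add: L_def degree_prod_eq_sum_degree)
    have "lead_coeff (L j) = 1" by (simp add: L_def lead_coeff_prod)
    then show "coeff (L j) n = 1" by (simp add: deg)
  qed
  have "poly P (x l) = 1" if "l \<in> A" for l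
  proof -
    have nz: "(\<Prod>i\<in>A - {l}. x l - x i) \<noteq> 0"
      using that assms by (auto simp: inj_on_def)
    have "poly (L j) (x l) = 0" if "j \<in> A" "j \<noteq> l" for j
      using \<open>l \<in> A\<close> that assms(1) by (auto simp: L_def poly_prod)
    then have "poly P (x l) = w l * poly (L l) (x l)"
      unfolding P_def poly_sum poly_smult using that assms(1)
      by (subst sum.remove[OF assms(1) that]) (simp add: sum.neutral)
    then show ?thesis using nz by (simp add: w_def L_def poly_prod)
  qed
  \<comment> \<open>The polynomial \<open>P - 1\<close> has \<open>n + 1\<close> roots but degree at
    most \<open>n\<close>, hence is zero.\<close>
  then have "x ` A \<subseteq> {a. poly (P - 1) a = 0}" by auto
  moreover have "card (x ` A) = Suc n" using assms(3) n by (simp add: card_image)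
  moreover have "degree (P - 1) \<le> n"
    unfolding P_def
    by (intro degree_diff_le degree_sum_le order_trans[OF degree_smult_le]) (use assms(1) L in auto)
  ultimately have "P - 1 = 0"
    using card_poly_roots_bound[of "P - 1"] poly_roots_finite[of "P - 1"]
      card_mono[of "{a. poly (P - 1) a = 0}" "x ` A"] by fastforce
  then have "coeff P n = 0" using n by (simp add: coeff_1)
  moreover have "coeff P n = (\<Sum>j\<in>A. w j)"
    unfolding P_def by (simp add: coeff_sum L)
  ultimately show ?thesis by (simp add: w_def)
qed

lemma cos_times_pi_eq_0_iff:
  assumes "0 \<le> x" "x \<le> 1 / 2"
  shows "cos (x * pi) = 0 \<longleftrightarrow> x = 1 / 2"
proof (cases "x = 1 / 2")
  case True
  have "1 / 2 * pi = pi / 2" by simp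
  then show ?thesis using True by (simp only: cos_pi_half refl)
next
  case False
  then have "cos (x * pi) > 0"
    using assms by (intro cos_gt_zero_pi) (auto intro: less_le_trans[of _ 0])
  then show ?thesis using False by simp
qed

lemma grid_rho_eq_0_iff:
  assumes "1 \<le> n" "j \<le> n"
  shows "grid_rho G orig n j = 0 \<longleftrightarrow> orig \<and> j = n"
proof (cases G)
  case CH1
  define x where "x = (real j + 1 / 2) / (real (grid_ell orig n) + 1)"
  have "0 \<le> x" "x \<le> 1 / 2" "x = 1 / 2 \<longleftrightarrow> orig \<and> j = n"
    using assms by (auto simp: x_def grid_ell_def field_simps)
  moreover have "grid_rho G orig n j = cos (x * pi)" using CH1 by (simp add: x_def)
  ultimately show ?thesis by (simp only: cos_times_pi_eq_0_iff)
next
  case CH2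
  define x where "x = real j / real (grid_ell orig n)"
  have "0 \<le> x" "x \<le> 1 / 2" "x = 1 / 2 \<longleftrightarrow> orig \<and> j = n"
    using assms by (auto simp: x_def grid_ell_def field_simps)
  moreover have "grid_rho G orig n j = cos (x * pi)" using CH2 by (simp add: x_def)
  ultimately show ?thesis by (simp only: cos_times_pi_eq_0_iff)
next
  case GL
  then show ?thesis using GL_node(3)[OF assms(2)] by simp
qed

lemma inj_on_GL_squares: "inj_on (\<lambda>j. (grid_rho GL orig n j)\<^sup>2) {0..n}"
proof (rule linorder_inj_onI')
  fix i j assume "i \<in> {0..n}" "j \<in> {0..n}" "i < j"
  then have "grid_rho GL orig n j < grid_rho GL orig n i" "0 \<le> grid_rho GL orig n j"
    using GL_node(1,2) by auto
  then have "(grid_rho GL orig n j)\<^sup>2 < (grid_rho GL orig n i)\<^sup>2"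
    by (intro power_strict_mono) auto
  then show "(grid_rho GL orig n i)\<^sup>2 \<noteq> (grid_rho GL orig n j)\<^sup>2" by simp
qed

text \<open>Node \<open>n\<close> is the origin, so this coefficient governs the even radial formula
  near \<open>r = 0\<close>.\<close>

lemma bary_coeff_last_nonzero:
  assumes "1 \<le> n"
  shows "bary_coeff G True n n \<noteq> 0"
proof (cases G)
  case CH1
  have "(2 * real n + 1) / (4 * real n + 2) * pi = pi / 2" by (simp add: field_simps)
  then show ?thesis using CH1 by (simp only: bary_coeff.simps) simp
next
  case CH2
  then show ?thesis by simp
next
  case GL
  then show ?thesis
    using inj_on_GL_squares[of True n] by (auto simp: gl_weight_def inj_on_def)
qed

text \<open>Each product \<open>2 * cos \<theta> * sin ((2 * real j + 1) * \<theta>)\<close> splits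
  into two neighbouring sines of even multiples of \<open>\<theta>\<close>, and the alternating
  signs make the sum telescope.\<close>

lemma sum_alternating_sin:
  "2 * cos \<theta> * (\<Sum>j<n. (-1) ^ j * sin ((2 * real j + 1) * \<theta>)) = - ((-1) ^ n * sin (2 * real n * \<theta>))"
proof (induction n)
  case (Suc n)
  have "2 * cos \<theta> * sin ((2 * real n + 1) * \<theta>) = sin (2 * real (Suc n) * \<theta>) + sin (2 * real n * \<theta>)"
  proof -
    have "2 * real (Suc n) * \<theta> = (2 * real n + 1) * \<theta> + \<theta>" "2 * real n * \<theta> = (2 * real n + 1) * \<theta> - \<theta>"
      by (simp_all add: algebra_simps)
    then show ?thesis by (simp only: sin_add sin_diff) simp
  qed
  then have "2 * cos \<theta> * ((-1) ^ n * sin ((2 * real n + 1) * \<theta>))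
      = (-1) ^ n * (sin (2 * real (Suc n) * \<theta>) + sin (2 * real n * \<theta>))"
    by (simp only: mult_ac)
  then show ?case
    unfolding sum.lessThan_Suc distrib_left[of "2 * cos \<theta>"] Suc.IH by (simp add: distrib_left)
qed simp

text \<open>Up to sign, this is the denominator of the odd radial formula at the origin.\<close>

lemma sum_bary_coeff_nonzero:
  assumes "1 \<le> n"
  shows "(\<Sum>j<n. bary_coeff G True n j) \<noteq> 0"
proof (cases G)
  case CH1
  define \<theta> where "\<theta> = pi / (4 * real n + 2)"
  have "(\<Sum>j<n. bary_coeff G True n j) = (\<Sum>j<n. (-1) ^ j * sin ((2 * real j + 1) * \<theta>))"
    using CH1 by (intro sum.cong refl) (simp add: \<theta>_def)
  \<comment> \<open>The angle is \<open>n * pi / (2 * n + 1)\<close>, strictly between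
    \<open>0\<close> and \<open>pi\<close>.\<close>
  moreover have "sin (2 * real n * \<theta>) > 0"
    using assms by (intro sin_gt_zero) (auto simp: \<theta>_def field_simps intro!: add_pos_nonneg)
  ultimately show ?thesis using sum_alternating_sin[of \<theta> n] by auto
next
  case CH2
  \<comment> \<open>Because the first term is halved, the partial sums alternate between
    \<open>1/2\<close> and \<open>-1/2\<close>.\<close>
  have "(\<Sum>j<k. bary_coeff CH2 True n j) = - ((-1) ^ k) / 2" if "1 \<le> k" "k \<le> n" for k
    using that
  proof (induction k rule: dec_induct)
    case (step k)
    then show ?case by simp
  qed simp
  from this[of n] show ?thesis using assms CH2 by simp
next
  case GL
  \<comment> \<open>The full sum of the GL weights vanishes, so omitting the last one leaves its
    negative.\<close>
  have "(\<Sum>j=0..n. bary_coeff G True n j) = 0"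
    using sum_inverse_prod_differences[OF _ _ inj_on_GL_squares[of True n]] assms GL
    by (simp add: gl_weight_def)
  moreover have "{0..n} = insert n {..<n}" by auto
  ultimately show ?thesis using bary_coeff_last_nonzero[OF assms, of G] by auto
qed

text \<open>The factor \<open>r\<close> forces the value \<open>0\<close> once the remaining
  quotient has a finite limit. With the origin as a node, the only term singular at \<open>0\<close>
  carries the factor \<open>\<rho> n = 0\<close>, so the quotient is continuous there.\<close>

lemma radial_odd_0:
  assumes "1 \<le> n"
  shows "radial_odd G orig m n d k 0 = 0"
proof (cases orig)
  case False
  then have "0 \<notin> radial_sing G orig n"
    using grid_rho_eq_0_iff[OF assms] by (auto simp: radial_sing_def)
  then show ?thesis by (simp add: radial_odd_def limiting_value_def Let_def)
next
  case True
  define \<rho> where "\<rho> = grid_rho G True n"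
  define c where "c = bary_coeff G True n"
  have \<rho>0: "\<rho> j = 0 \<longleftrightarrow> j = n" if "j \<le> n" for j
    using grid_rho_eq_0_iff[OF assms that, of G True] by (simp add: \<rho>_def)
  then have sing: "0 \<in> radial_sing G orig n"
    using True by (auto simp: radial_sing_def \<rho>_def)
  \<comment> \<open>For \<open>\<rho> j = 0\<close> both sides are \<open>0\<close>. The free
    \<open>b\<close> stands for \<open>c j\<close> in the numerator and for
    \<open>c j * \<rho> j\<close> in the denominator.\<close>
  have summand: "((\<lambda>r. b * \<rho> j / (r\<^sup>2 - (\<rho> j)\<^sup>2)) \<longlongrightarrow> b * \<rho> j / (0\<^sup>2 - (\<rho> j)\<^sup>2)) (at 0)"
    if "j \<le> n" for b j
    by (cases "\<rho> j = 0") (auto intro!: tendsto_eq_intros)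
  have "(\<Sum>j=0..n. c j * \<rho> j * \<rho> j / (0\<^sup>2 - (\<rho> j)\<^sup>2)) = (\<Sum>j<n. - c j)"
  proof -
    have "{0..n} = insert n {..<n}" by auto
    moreover have "(\<Sum>j<n. c j * \<rho> j * \<rho> j / (0\<^sup>2 - (\<rho> j)\<^sup>2)) = (\<Sum>j<n. - c j)"
      by (intro sum.cong refl) (use \<rho>0 in \<open>auto simp: power2_eq_square\<close>)
    ultimately show ?thesis using \<rho>0 by simp
  qed
  then have denominator: "(\<Sum>j=0..n. c j * \<rho> j * \<rho> j / (0\<^sup>2 - (\<rho> j)\<^sup>2)) \<noteq> 0"
    using sum_bary_coeff_nonzero[OF assms, of G] by (simp add: c_def sum_negf)
  have "((\<lambda>r. of_real r *
          ((\<Sum>j=0..n. of_real (c j * \<rho> j / (r\<^sup>2 - (\<rho> j)\<^sup>2)) * data_minus m d j k)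
           / of_real (\<Sum>j=0..n. c j * \<rho> j * \<rho> j / (r\<^sup>2 - (\<rho> j)\<^sup>2)))) \<longlongrightarrow>
        of_real 0 *
          ((\<Sum>j=0..n. of_real (c j * \<rho> j / (0\<^sup>2 - (\<rho> j)\<^sup>2)) * data_minus m d j k)
           / of_real (\<Sum>j=0..n. c j * \<rho> j * \<rho> j / (0\<^sup>2 - (\<rho> j)\<^sup>2)))) (at 0)"
    by (intro tendsto_intros summand) (use denominator in \<open>auto simp del: of_real_sum\<close>)
  then have "((\<lambda>r. of_real r *
          ((\<Sum>j=0..n. of_real (c j * \<rho> j / (r\<^sup>2 - (\<rho> j)\<^sup>2)) * data_minus m d j k)
           / of_real (\<Sum>j=0..n. c j * (\<rho> j)\<^sup>2 / (r\<^sup>2 - (\<rho> j)\<^sup>2)))) \<longlongrightarrow> 0) (at 0)"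
    by (simp add: power2_eq_square mult.assoc)
  then show ?thesis
    using True sing
    by (simp add: radial_odd_def limiting_value_def Let_def \<rho>_def c_def tendsto_Lim del: of_real_sum)
qed

text \<open>Multiplying numerator and denominator by \<open>r\<^sup>2\<close> turns the term of the
  origin into the constant \<open>c n\<close>, while all others tend to \<open>0\<close>.\<close>

lemma radial_even_0:
  assumes "1 \<le> n"
  shows "radial_even G True m n d k 0 = data_plus m d n k"
proof -
  define \<rho> where "\<rho> = grid_rho G True n"
  define c where "c = bary_coeff G True n"
  define D where "D j = data_plus m d j k" for j
  have \<rho>0: "\<rho> j = 0 \<longleftrightarrow> j = n" if "j \<le> n" for j
    using grid_rho_eq_0_iff[OF assms that, of G True] by (simp add: \<rho>_def)
  then have sing: "0 \<in> radial_sing G True n"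
    by (auto simp: radial_sing_def \<rho>_def)
  have summand: "((\<lambda>r. r\<^sup>2 * (c j / (r\<^sup>2 - (\<rho> j)\<^sup>2))) \<longlongrightarrow> (if j = n then c n else 0)) (at 0)"
    if "j \<le> n" for j
  proof (cases "j = n")
    case True
    have "((\<lambda>r. c n) \<longlongrightarrow> c n) (at (0::real))" by simp
    then have "((\<lambda>r. r\<^sup>2 * (c n / (r\<^sup>2 - (\<rho> n)\<^sup>2))) \<longlongrightarrow> c n) (at 0)"
      by (rule Lim_transform_eventually) (use \<rho>0[of n] in \<open>auto simp: eventually_at intro!: exI[of _ 1]\<close>)
    then show ?thesis using True by simp
  next
    case False
    then show ?thesis using \<rho>0[OF that] by (auto intro!: tendsto_eq_intros)
  qed
  have "((\<lambda>r. (\<Sum>j=0..n. of_real (r\<^sup>2 * (c j / (r\<^sup>2 - (\<rho> j)\<^sup>2))) * D j)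
        / of_real (\<Sum>j=0..n. r\<^sup>2 * (c j / (r\<^sup>2 - (\<rho> j)\<^sup>2)))) \<longlongrightarrow>
      (\<Sum>j=0..n. of_real (if j = n then c n else 0) * D j)
        / of_real (\<Sum>j=0..n. if j = n then c n else 0)) (at 0)"
    by (intro tendsto_intros summand)
       (use bary_coeff_last_nonzero[OF assms, of G] in \<open>auto simp: c_def\<close>)
  also have "(\<Sum>j=0..n. of_real (if j = n then c n else 0) * D j) = of_real (c n) * D n"
    by (simp add: if_distrib[of of_real] if_distrib[of "\<lambda>x. x * _"] cong: if_cong)
  also have "of_real (c n) * D n / of_real (\<Sum>j=0..n. if j = n then c n else 0) = D n"
    using bary_coeff_last_nonzero[OF assms, of G] by (simp add: c_def)
  finally have "((\<lambda>r. (\<Sum>j=0..n. of_real (c j / (r\<^sup>2 - (\<rho> j)\<^sup>2)) * D j)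
        / of_real (\<Sum>j=0..n. c j / (r\<^sup>2 - (\<rho> j)\<^sup>2))) \<longlongrightarrow> D n) (at 0)"
  proof (rule Lim_transform_eventually)
    have "(\<Sum>j=0..n. of_real (r\<^sup>2 * (c j / (r\<^sup>2 - (\<rho> j)\<^sup>2))) * D j)
          / of_real (\<Sum>j=0..n. r\<^sup>2 * (c j / (r\<^sup>2 - (\<rho> j)\<^sup>2)))
        = (\<Sum>j=0..n. of_real (c j / (r\<^sup>2 - (\<rho> j)\<^sup>2)) * D j)
          / of_real (\<Sum>j=0..n. c j / (r\<^sup>2 - (\<rho> j)\<^sup>2))" if "r \<noteq> 0" for r
      unfolding sum_distrib_left[symmetric] of_real_mult[of "r\<^sup>2"] mult.assoc using that by simp
    then show "\<forall>\<^sub>F r in at 0. (\<Sum>j=0..n. of_real (r\<^sup>2 * (c j / (r\<^sup>2 - (\<rho> j)\<^sup>2))) * D j)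
          / of_real (\<Sum>j=0..n. r\<^sup>2 * (c j / (r\<^sup>2 - (\<rho> j)\<^sup>2)))
        = (\<Sum>j=0..n. of_real (c j / (r\<^sup>2 - (\<rho> j)\<^sup>2)) * D j)
          / of_real (\<Sum>j=0..n. c j / (r\<^sup>2 - (\<rho> j)\<^sup>2))"
      by (auto simp: eventually_at_filter)
  qed
  then show ?thesis
    using sing
    by (simp add: radial_even_def limiting_value_def Let_def \<rho>_def c_def D_def tendsto_Lim
        del: of_real_sum)
qed

subsection \<open>The disk interpolant\<close>

text \<open>\<open>Lim\<close> is a definite description over limits, so it suffices that
  \<open>F\<close> has the same limits at \<open>x + p\<close> and at \<open>x\<close>; existence of
  a limit is not at issue.\<close>

lemma limiting_value_shift:
  assumes "\<And>x. x + p \<in> S \<longleftrightarrow> x \<in> S" and "\<And>x. F (x + p) = F x"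
  shows "limiting_value S F (x + p) = limiting_value S F x"
proof -
  have "F (x + p + h) = F (x + h)" for h
    using assms(2)[of "x + h"] by (simp add: ac_simps)
  then have "(F \<longlongrightarrow> l) (at (x + p)) \<longleftrightarrow> (F \<longlongrightarrow> l) (at x)" for l
    using LIM_offset_zero_iff[of "x + p" F l] LIM_offset_zero_iff[of x F l] by simp
  then show ?thesis by (simp add: limiting_value_def Topological_Spaces.Lim_def assms)
qed

lemma shift_by_pi:
  "sin (t + pi - a) = - sin (t - a)"
  "cot (t + pi - a) = cot (t - a)" "csc (t + pi - a) = - csc (t - a)"
proof -
  have *: "t + pi - a = (t - a) + pi" by simp
  show "sin (t + pi - a) = - sin (t - a)"
    "cot (t + pi - a) = cot (t - a)" "csc (t + pi - a) = - csc (t - a)"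
    unfolding * by (simp_all add: cot_def csc_def)
qed

lemma shift_by_2pi:
  "sin (t + 2 * pi - a) = sin (t - a)" "cot (t + 2 * pi - a) = cot (t - a)"
  "csc (t + 2 * pi - a) = csc (t - a)"
proof -
  have *: "t + 2 * pi - a = (t - a) + 2 * pi" by simp
  show "sin (t + 2 * pi - a) = sin (t - a)" "cot (t + 2 * pi - a) = cot (t - a)"
    "csc (t + 2 * pi - a) = csc (t - a)"
    unfolding * by (simp_all add: cot_def csc_def)
qed

lemma disk_interpolant_shift_2pi:
  "disk_interpolant G orig m n d (t + 2 * pi) r = disk_interpolant G orig m n d t r"
  unfolding disk_interpolant_def Let_def
  by (rule limiting_value_shift) (simp_all add: angular_sing_def shift_by_2pi)

text \<open>Without the odd part, numerator and denominator contain only cotangents or only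
  cosecants, so a sign change under the shift cancels.\<close>

lemma disk_interpolant_shift_pi_0:
  assumes "1 \<le> n"
  shows "disk_interpolant G orig m n d (t + pi) 0 = disk_interpolant G orig m n d t 0"
  unfolding disk_interpolant_def Let_def radial_odd_0[OF assms]
  by (rule limiting_value_shift) (simp_all add: angular_sing_def shift_by_pi sum_negf)

lemma eventually_sin_nonzero: "\<forall>\<^sub>F y in at a. sin (y - b) \<noteq> 0" for a b :: real
proof (cases "sin (a - b) = 0")
  case False
  have "((\<lambda>y. sin (y - b)) \<longlongrightarrow> sin (a - b)) (at a)" by (intro tendsto_intros)
  then show ?thesis using False by (rule tendsto_imp_eventually_ne)
next
  case True
  then have "cos (a - b) \<noteq> 0" using sin_cos_squared_add[of "a - b"] by auto
  have "sin (y - b) \<noteq> 0" if "y \<noteq> a" "dist y a < pi" for y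
  proof -
    have "sin (y - a) \<noteq> 0"
      using that sin_gt_zero[of "y - a"] sin_gt_zero[of "a - y"] sin_minus[of "y - a"]
      by (cases "a < y") (auto simp: dist_real_def)
    \<comment> \<open>Since \<open>sin (a - b) = 0\<close>, only one term of the addition formula
      remains.\<close>
    moreover have "sin (y - b) = cos (a - b) * sin (y - a)"
      using sin_add[of "a - b" "y - a"] True by simp
    ultimately show ?thesis using \<open>cos (a - b) \<noteq> 0\<close> by simp
  qed
  then show ?thesis unfolding eventually_at using pi_gt_zero by blast
qed

lemma eventually_notin_angular_sing: "\<forall>\<^sub>F t in at a. t \<notin> angular_sing m"
proof -
  have "\<forall>\<^sub>F t in at a. \<forall>k\<in>{..<m}. sin (t - grid_phi m k) \<noteq> 0"
    by (intro eventually_ball_finite) (auto intro: eventually_sin_nonzero)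
  then show ?thesis by (rule eventually_mono) (auto simp: angular_sing_def)
qed

lemma disk_interpolant_origin:
  assumes "1 \<le> m" "1 \<le> n"
  shows "disk_interpolant G True m n (grid_samples G True m n f) t 0 = f (0, 0)"
proof -
  \<comment> \<open>The samples at node \<open>n\<close> are all taken at the centre, independently
    of the angle.\<close>
  have even0: "radial_even G True m n (grid_samples G True m n f) k 0 = f (0, 0)" for k
    using grid_rho_eq_0_iff[OF assms(2), of n G True]
    by (simp add: radial_even_0[OF assms(2)] data_plus_def grid_samples_def)
  \<comment> \<open>A function that is constant off the isolated singular angles has that constant
    as its limit at them.\<close>
  have "limiting_value (angular_sing m) F t = f (0, 0)"
    if "\<And>t. t \<notin> angular_sing m \<Longrightarrow> F t = f (0, 0)" for F
  proof -
    have "\<forall>\<^sub>F u in at t. f (0, 0) = F u"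
      using eventually_notin_angular_sing[of m t] by (rule eventually_mono) (simp add: that)
    then have "(F \<longlongrightarrow> f (0, 0)) (at t)" by (rule Lim_transform_eventually[OF tendsto_const])
    then show ?thesis using that by (simp add: limiting_value_def tendsto_Lim)
  qed
  then show ?thesis
    unfolding disk_interpolant_def Let_def radial_odd_0[OF assms(2)] even0
  proof this
    fix t assume t: "t \<notin> angular_sing m"
    \<comment> \<open>Constant data factor out of the weighted mean; a vanishing denominator would
      give \<open>0\<close> instead of \<open>z\<close>.\<close>
    have const: "(\<Sum>k<m. (-1) ^ k * (of_real (u k) * z)) / of_real (\<Sum>k<m. (-1) ^ k * u k) = z"
      if "(\<Sum>k<m. (-1) ^ k * u k) \<noteq> 0" for u :: "nat \<Rightarrow> real" and z :: complex
    proof -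
      have "(\<Sum>k<m. (-1) ^ k * (of_real (u k) * z)) = of_real (\<Sum>k<m. (-1) ^ k * u k) * z"
        by (simp add: sum_distrib_right mult.assoc)
      then show ?thesis using that by (simp del: of_real_sum)
    qed
    show "(if even m then
           (\<lambda>t. (\<Sum>k<m. (-1) ^ k * (of_real (cot (t - grid_phi m k)) * f (0, 0) + of_real (csc (t - grid_phi m k)) * 0))
                / of_real (\<Sum>k<m. (-1) ^ k * cot (t - grid_phi m k)))
         else
           (\<lambda>t. (\<Sum>k<m. (-1) ^ k * (of_real (csc (t - grid_phi m k)) * f (0, 0) + of_real (cot (t - grid_phi m k)) * 0))
                / of_real (\<Sum>k<m. (-1) ^ k * csc (t - grid_phi m k)))) t = f (0, 0)"
      using alternating_cot_sum_nonzero[OF assms(1) t] alternating_csc_sum_nonzero[OF assms(1) t]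
      by (simp add: const del: of_real_sum)
  qed
qed

theorem theorem2:
  fixes m n :: nat and f :: "real \<times> real \<Rightarrow> complex"
    and G :: grid_kind and orig :: bool
    and s :: "real \<Rightarrow> real \<Rightarrow> complex"
  assumes "m \<ge> 1" and "n \<ge> 1"
    and "continuous_on (cball (0, 0) 1) f"
    and "s = disk_interpolant G orig m n (grid_samples G orig m n f)"
  shows "(\<exists>F. dfs_extension s F) \<and>
         (\<forall>F. dfs_extension s F \<longrightarrow> bmc pi 1 F \<and> (orig \<longrightarrow> bmc_II pi 1 F))"
proof (intro conjI allI impI)
  have shift2: "s (t + 2 * pi) r = s t r" for t r
    using disk_interpolant_shift_2pi assms(4) by simp
  have shift0: "s (t + pi) 0 = s t 0" for t
    using disk_interpolant_shift_pi_0[OF assms(2)] assms(4) by simp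
  show "\<exists>F. dfs_extension s F"
  proof
    \<comment> \<open>The blocks meet at \<open>r = 0\<close>, where \<open>shift0\<close>
      reconciles the two branches.\<close>
    define F where "F t r = (if 0 \<le> r then s t r else s (t + pi) (- r))" for t r
    show "dfs_extension s F"
      unfolding dfs_extension_def glued_blocks_def
    proof (intro conjI ballI)
      \<comment> \<open>The lower right block is the one that needs the full period: for
        \<open>y < 0\<close> it compares \<open>s\<close> at \<open>x + pi\<close> and
        \<open>x - pi\<close>.\<close>
      fix x y :: real assume "x \<in> {pi..2 * pi}" "y \<in> {- 1..0}"
      then show "F x y = s (x - pi) (- y)"
        using shift2[of "x - pi" "- y"] shift0[of "x - pi"] by (auto simp: F_def add_ac)
    qed (auto simp: F_def shift0)
  qed
  fix F assume "dfs_extension s F"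
  then have glued: "glued_blocks pi 1 s (\<lambda>t r. s (t + pi) r) F"
    by (simp add: dfs_extension_def)
  then have F: "F x y = s x y" if "x \<in> {0..2 * pi}" "y \<in> {0..1}" for x y
    using that by (cases "x \<le> pi") (auto simp: glued_blocks_def)
  have "F 0 y = F (2 * pi) y" if "y \<in> {- 1..1}" for y
  proof (cases "0 \<le> y")
    case True
    then show ?thesis using F[of 0 y] F[of "2 * pi" y] shift2[of 0 y] that by simp
  next
    case False
    \<comment> \<open>For negative \<open>y\<close> the left and right blocks both evaluate
      \<open>s\<close> at the angle \<open>pi\<close>.\<close>
    then have "F 0 y = s (0 + pi) (- y)" "F (2 * pi) y = s (2 * pi - pi) (- y)"
      using glued that unfolding glued_blocks_def by auto
    then show ?thesis by simp
  qed
  then show "bmc pi 1 F" using glued unfolding bmc_def by blast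
  moreover have "F x 0 = f (0, 0)" if orig "x \<in> {0..2 * pi}" for x
    using F[OF that(2), of 0] disk_interpolant_origin[OF assms(1,2)] that(1) assms(4) by simp
  ultimately show "bmc_II pi 1 F" if orig using that unfolding bmc_II_def by blast
qed

end
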